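(* Let $\sigma>0$, let $1\le r<n$, $\ell\ge1$ and $r<s_1<s_2<\dots<s_\ell\le n$. Let $X_{1:n}<\dots<X_{n:n}$ be the order statistics of a sample of size $n$ from the density $\frac1\sigma f\left(\frac{x}{\sigma}\right)$, and let $\boldsymbol X=(X_{1:n},\dots,X_{r:n})^\top$. Then the simultaneous best linear invariant predictors of $(X_{s_1:n},\dots,X_{s_\ell:n})$ based on $\boldsymbol X$ are identical to the corresponding marginal best linear invariant predictors of $X_{s_1:n},\dots,X_{s_\ell:n}$.
   Context: $f$ is a probability density on $\mathbb{R}$, and the sample consists of $n$ i.i.d. random variables with density $\frac1\sigma f\left(\frac{x}{\sigma}\right)$ (scale family). Put $Z_{i:n}=X_{i:n}/\sigma$, assumed to have finite second moments; the $r\times r$ covariance matrix of $(Z_{1:n},\dots,Z_{r:n})^\top$ is assumed positive definite. Marginal best linear invariant predictor of $X_{s:n}$ ($r<s\le n$): the predictor $\boldsymbol a^\top\boldsymbol X$ minimizing $E[(\boldsymbol a^\top\boldsymbol X-X_{s:n})^2]$ over $\boldsymbol a\in\mathbb{R}^r$. Simultaneous best linear invariant predictors of $(X_{s_1:n},\dots,X_{s_\ell:n})$: the tuple $(\boldsymbol a_1^\top\boldsymbol X,\dots,\boldsymbol a_\ell^\top\boldsymbol X)$ minimizing, over $(\boldsymbol a_1,\dots,\boldsymbol a_\ell)\in(\mathbb{R}^r)^\ell$, the determinant of the $\ell\times\ell$ mean squared predictive error matrix $\boldsymbol W=(W_{ij})$, $W_{ij}=E[(\boldsymbol a_i^\top\boldsymbol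 X-X_{s_i:n})(\boldsymbol a_j^\top\boldsymbol X-X_{s_j:n})]$. *)

theory Defs
  imports "HOL-Probability.Probability" "Jordan_Normal_Form.Determinant"
begin

definition prob_density :: "(real \<Rightarrow> real) \<Rightarrow> bool" where
  "prob_density f \<longleftrightarrow> (\<forall>x. 0 \<le> f x) \<and> has_bochner_integral lborel f 1"

definition iid_sample :: "'a measure \<Rightarrow> nat \<Rightarrow> (real \<Rightarrow> real) \<Rightarrow> (nat \<Rightarrow> 'a \<Rightarrow> real) \<Rightarrow> bool" where
  "iid_sample M n g Y \<longleftrightarrow>
     prob_space.indep_vars M (\<lambda>_. borel) Y {1..n} \<and>
     (\<forall>i\<in>{1..n}. distributed M lborel (Y i) (\<lambda>x. ennreal (g x)))"

(* The i-th smallest of Y 1, ..., Y n, counted from i = 1; meaningful for 1 <= i <= n only. *)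
definition order_stat :: "nat \<Rightarrow> (nat \<Rightarrow> 'a \<Rightarrow> real) \<Rightarrow> nat \<Rightarrow> 'a \<Rightarrow> real" where
  "order_stat n Y i \<omega> = sort (map (\<lambda>j. Y j \<omega>) [1..<Suc n]) ! (i - 1)"

definition covariance :: "'a measure \<Rightarrow> ('a \<Rightarrow> real) \<Rightarrow> ('a \<Rightarrow> real) \<Rightarrow> real" where
  "covariance M U V =
     (LINT \<omega>|M. (U \<omega> - (LINT \<omega>'|M. U \<omega>')) * (V \<omega> - (LINT \<omega>'|M. V \<omega>')))"

(* Matrix and vector indices start at 0, order statistics at 1; hence the Suc here and below. *)
definition cov_matrix :: "'a measure \<Rightarrow> (nat \<Rightarrow> 'a \<Rightarrow> real) \<Rightarrow> nat \<Rightarrow> real Matrix.mat" where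
  "cov_matrix M Z r = Matrix.mat r r (\<lambda>(i, j). covariance M (Z (Suc i)) (Z (Suc j)))"

definition pos_def_matrix :: "nat \<Rightarrow> real Matrix.mat \<Rightarrow> bool" where
  "pos_def_matrix r A \<longleftrightarrow>
     A \<in> carrier_mat r r \<and> transpose_mat A = A \<and>
     (\<forall>v\<in>carrier_vec r. v \<noteq> 0\<^sub>v r \<longrightarrow> scalar_prod v (A *\<^sub>v v) > 0)"

definition obs_vec :: "(nat \<Rightarrow> 'a \<Rightarrow> real) \<Rightarrow> nat \<Rightarrow> 'a \<Rightarrow> real Matrix.vec" where
  "obs_vec X r \<omega> = Matrix.vec r (\<lambda>k. X (Suc k) \<omega>)"

definition pred_err :: "(nat \<Rightarrow> 'a \<Rightarrow> real) \<Rightarrow> nat \<Rightarrow> nat \<Rightarrow> real Matrix.vec \<Rightarrow> 'a \<Rightarrow> real" where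
  "pred_err X r s a \<omega> = scalar_prod a (obs_vec X r \<omega>) - X s \<omega>"

(* A predictor is represented by its coefficient vector. *)
definition marginal_blip ::
  "'a measure \<Rightarrow> (nat \<Rightarrow> 'a \<Rightarrow> real) \<Rightarrow> nat \<Rightarrow> nat \<Rightarrow> real Matrix.vec \<Rightarrow> bool" where
  "marginal_blip M X r s a \<longleftrightarrow>
     is_arg_min (\<lambda>b. LINT \<omega>|M. (pred_err X r s b \<omega>)\<^sup>2) (\<lambda>b. b \<in> carrier_vec r) a"

(* The list ss holds the ranks to be predicted, the list as one coefficient vector for each. *)
definition mspe_matrix ::
  "'a measure \<Rightarrow> (nat \<Rightarrow> 'a \<Rightarrow> real) \<Rightarrow> nat \<Rightarrow> nat list \<Rightarrow> real Matrix.vec list \<Rightarrow> real Matrix.mat" where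
  "mspe_matrix M X r ss as = Matrix.mat (length ss) (length ss)
     (\<lambda>(i, j). LINT \<omega>|M. pred_err X r (ss ! i) (as ! i) \<omega> * pred_err X r (ss ! j) (as ! j) \<omega>)"

definition simultaneous_blip ::
  "'a measure \<Rightarrow> (nat \<Rightarrow> 'a \<Rightarrow> real) \<Rightarrow> nat \<Rightarrow> nat list \<Rightarrow> real Matrix.vec list \<Rightarrow> bool" where
  "simultaneous_blip M X r ss as \<longleftrightarrow>
     is_arg_min (\<lambda>bs. Determinant.det (mspe_matrix M X r ss bs))
       (\<lambda>bs. length bs = length ss \<and> set bs \<subseteq> carrier_vec r) as"

end

theory Submission
  imports Defs
begin

text \<open>By the normal equations, the error of a marginal best predictor is orthogonal in \<open>L\<^sup>2\<close> to all
  linear functions of the observations. Hence the error matrix of an arbitrary tuple of predictors is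
  \<open>W + P\<close>, where \<open>W\<close> is the error matrix of the marginal best predictors and \<open>P\<close> is the Gram matrix
  of the deviations from them. No nontrivial linear combination of the order statistics vanishes with
  positive probability, because the sample is independent and atomless; this makes \<open>W\<close> positive
  definite. For such \<open>W\<close> and positive semidefinite \<open>P\<close>, \<open>det (W + P) \<ge> det W\<close>, and equality
  forces the diagonal of \<open>P\<close>, that is, all deviations, to vanish.\<close>

section \<open>Determinants of positive definite matrices\<close>

abbreviation mat_of :: "nat \<Rightarrow> (nat \<Rightarrow> nat \<Rightarrow> real) \<Rightarrow> real Matrix.mat" where
  "mat_of k G \<equiv> Matrix.mat k k (\<lambda>(i, j). G i j)"

definition qform :: "nat \<Rightarrow> (nat \<Rightarrow> nat \<Rightarrow> real) \<Rightarrow> (nat \<Rightarrow> real) \<Rightarrow> real" where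
  "qform k G x = (\<Sum>i<k. \<Sum>j<k. x i * x j * G i j)"

text \<open>Symmetry is demanded at all indices, not only below \<open>k\<close>; Gram functions
  have it anyway, and passing to a smaller \<open>k\<close> then concerns the form alone.\<close>

definition pos_def_upto :: "nat \<Rightarrow> (nat \<Rightarrow> nat \<Rightarrow> real) \<Rightarrow> bool" where
  "pos_def_upto k G \<longleftrightarrow> (\<forall>i j. G i j = G j i) \<and> (\<forall>x. (\<exists>i<k. x i \<noteq> 0) \<longrightarrow> qform k G x > 0)"

lemma linear_system_solvable:
  assumes "Determinant.det (mat_of k G) \<noteq> 0"
  obtains c where "\<And>i. i < k \<Longrightarrow> (\<Sum>j<k. G i j * c j) = b i"
proof -
  have A: "mat_of k G \<in> carrier_mat k k" by simp
  \<comment> \<open>The \<open>()\<close> merely fills the extension slot of the matrix ring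
    record.\<close>
  from det_non_zero_imp_unit[OF A assms, where b = "()"]
  obtain B where B: "B \<in> carrier_mat k k" "mat_of k G * B = 1\<^sub>m k"
    unfolding Units_def ring_mat_def by auto
  define v where "v = B *\<^sub>v Matrix.vec k b"
  have v: "v \<in> carrier_vec k" using B unfolding v_def by auto
  have "mat_of k G *\<^sub>v v = (mat_of k G * B) *\<^sub>v Matrix.vec k b"
    unfolding v_def using B by (subst assoc_mult_mat_vec[OF A B(1)]) auto
  also have "\<dots> = Matrix.vec k b" using B by simp
  finally have *: "mat_of k G *\<^sub>v v = Matrix.vec k b" .
  show thesis
  proof (rule that[of "\<lambda>j. vec_index v j"])
    fix i assume "i < k"
    then have "vec_index (mat_of k G *\<^sub>v v) i = b i" unfolding * by simp
    then show "(\<Sum>j<k. G i j * vec_index v j) = b i"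
      using \<open>i < k\<close> v by (simp add: scalar_prod_def row_def atLeast0LessThan)
  qed
qed

text \<open>Replacing the last column of \<open>G\<close> by \<open>G c\<close> is a column
  operation of determinant 1, because \<open>c k = 1\<close>. The new column is zero above its last
  entry, so Laplace expansion along it leaves one term; that last entry is the Schur complement of
  the leading block.\<close>

lemma det_schur_complement:
  assumes c: "\<And>i. i < k \<Longrightarrow> (\<Sum>j<Suc k. G i j * c j) = 0" and ck: "c k = 1"
  shows "Determinant.det (mat_of (Suc k) G) = Determinant.det (mat_of k G) * (\<Sum>j<Suc k. G k j * c j)"
proof -
  \<comment> \<open>The identity matrix with its last column replaced by \<open>c\<close>: right
    multiplication by it performs the column operation, and \<open>c k = 1\<close> puts only ones on
    its diagonal.\<close>
  define E where "E = mat_of (Suc k) (\<lambda>i j. if j = k then c i else if i = j then 1 else 0)"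
  have E: "E \<in> carrier_mat (Suc k) (Suc k)" unfolding E_def by simp
  have G: "mat_of (Suc k) G \<in> carrier_mat (Suc k) (Suc k)" by simp
  have detE: "Determinant.det E = 1"
  proof -
    have "upper_triangular E" unfolding E_def by auto
    then have "Determinant.det E = prod_list (diag_mat E)" using det_upper_triangular[OF _ E] by blast
    also have "\<dots> = (\<Prod>i<Suc k. E $$ (i, i))"
      using E by (simp add: prod_list_diag_prod atLeast0LessThan)
    also have "\<dots> = 1" unfolding E_def using ck by (intro prod.neutral) auto
    finally show ?thesis .
  qed
  define P where "P = mat_of (Suc k) G * E"
  have P: "P \<in> carrier_mat (Suc k) (Suc k)" using E unfolding P_def by auto
  have entry: "P $$ (i, j) = (\<Sum>m<Suc k. G i m * E $$ (m, j))" if "i < Suc k" "j < Suc k" for i j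
    unfolding P_def using that E by (simp add: scalar_prod_def row_def col_def atLeast0LessThan)
  have colk: "P $$ (i, k) = (\<Sum>m<Suc k. G i m * c m)" if "i < Suc k" for i
  proof -
    have "P $$ (i, k) = (\<Sum>m<Suc k. G i m * E $$ (m, k))" by (rule entry[OF that]) simp
    also have "\<dots> = (\<Sum>m<Suc k. G i m * c m)" unfolding E_def by (rule sum.cong) auto
    finally show ?thesis .
  qed
  have colj: "P $$ (i, j) = G i j" if "i < Suc k" "j < k" for i j
  proof -
    have "P $$ (i, j) = (\<Sum>m<Suc k. G i m * E $$ (m, j))" by (rule entry) (use that in auto)
    also have "\<dots> = (\<Sum>m<Suc k. if m = j then G i m else 0)"
      unfolding E_def using that by (intro sum.cong) auto
    also have "\<dots> = G i j" using that by simp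
    finally show ?thesis .
  qed
  have del: "mat_delete P k k = mat_of k G"
  proof (rule eq_matI)
    fix i j assume ij: "i < dim_row (mat_of k G)" "j < dim_col (mat_of k G)"
    then show "mat_delete P k k $$ (i, j) = mat_of k G $$ (i, j)"
      using P colj[of i j] by (simp add: mat_delete_def)
  qed (use P in auto)
  have "Determinant.det P = (\<Sum>i<Suc k. P $$ (i, k) * cofactor P i k)"
    by (rule laplace_expansion_column[OF P]) simp
  also have "\<dots> = P $$ (k, k) * cofactor P k k"
    using colk c by simp
  also have "cofactor P k k = Determinant.det (mat_of k G)"
    by (simp add: cofactor_def del)
  finally have "Determinant.det P = (\<Sum>m<Suc k. G k m * c m) * Determinant.det (mat_of k G)"
    using colk[of k] by simp
  moreover have "Determinant.det P = Determinant.det (mat_of (Suc k) G)"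
    unfolding P_def using det_mult[OF G E] detE by simp
  ultimately show ?thesis by simp
qed

lemma qform_cong: "(\<And>i. i < k \<Longrightarrow> x i = y i) \<Longrightarrow> qform k G x = qform k G y"
  unfolding qform_def by (intro sum.cong) auto

lemma qform_add:
  assumes "\<And>i j. G i j = G j i"
  shows "qform k G (\<lambda>i. x i + y i) =
    qform k G x + 2 * (\<Sum>i<k. y i * (\<Sum>j<k. G i j * x j)) + qform k G y"
proof -
  have s: "(\<Sum>i<k. \<Sum>j<k. x i * y j * G i j) = (\<Sum>i<k. \<Sum>j<k. y i * x j * G i j)"
    by (subst sum.swap) (simp add: assms mult.commute mult.left_commute)
  have "qform k G (\<lambda>i. x i + y i) = (\<Sum>i<k. \<Sum>j<k. x i * x j * G i j) + (\<Sum>i<k. \<Sum>j<k. x i * y j * G i j)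
     + (\<Sum>i<k. \<Sum>j<k. y i * x j * G i j) + (\<Sum>i<k. \<Sum>j<k. y i * y j * G i j)"
    unfolding qform_def by (simp add: algebra_simps sum.distrib)
  also have "\<dots> = qform k G x + 2 * (\<Sum>i<k. \<Sum>j<k. y i * x j * G i j) + qform k G y"
    unfolding qform_def s by simp
  also have "(\<Sum>i<k. \<Sum>j<k. y i * x j * G i j) = (\<Sum>i<k. y i * (\<Sum>j<k. G i j * x j))"
    by (simp add: sum_distrib_left mult_ac)
  finally show ?thesis .
qed

lemma qform_Suc_restrict: "x k = 0 \<Longrightarrow> qform (Suc k) G x = qform k G x"
  unfolding qform_def by simp

lemma pos_def_upto_mono: "pos_def_upto (Suc k) G \<Longrightarrow> pos_def_upto k G"
proof -
  assume G: "pos_def_upto (Suc k) G"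
  have "qform k G x > 0" if "\<exists>i<k. x i \<noteq> 0" for x
  proof -
    have "qform (Suc k) G (x(k := 0)) > 0"
      using G that unfolding pos_def_upto_def
      by (metis fun_upd_apply less_Suc_eq nat_neq_iff)
    also have "qform (Suc k) G (x(k := 0)) = qform k G (x(k := 0))" by (rule qform_Suc_restrict) simp
    also have "\<dots> = qform k G x" by (rule qform_cong) simp
    finally show ?thesis .
  qed
  then show ?thesis using G unfolding pos_def_upto_def by blast
qed

lemma qform_nonneg: "pos_def_upto k G \<Longrightarrow> qform k G x \<ge> 0"
proof (cases "\<exists>i<k. x i \<noteq> 0")
  case False
  then have "qform k G x = 0" unfolding qform_def by simp
  then show ?thesis by simp
qed (auto simp: pos_def_upto_def intro: less_imp_le)

text \<open>Among vectors with last coordinate 1, the form is smallest where its gradient vanishes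
  in the first \<open>k\<close> coordinates. There the value of the form is the Schur complement,
  hence the ratio of consecutive leading minors. This variational description makes the ratios for
  two matrices comparable.\<close>

lemma leading_minor_ratio:
  assumes G: "pos_def_upto (Suc k) G" and nz: "Determinant.det (mat_of k G) \<noteq> 0"
  obtains c where "c k = 1"
    and "Determinant.det (mat_of (Suc k) G) = Determinant.det (mat_of k G) * qform (Suc k) G c"
    and "\<And>x. x k = 1 \<Longrightarrow> qform (Suc k) G c \<le> qform (Suc k) G x"
proof -
  \<comment> \<open>Stationarity in the first \<open>k\<close> coordinates, with the contribution of
    the fixed last coordinate 1 moved to the right-hand side.\<close>
  obtain d where d: "\<And>i. i < k \<Longrightarrow> (\<Sum>j<k. G i j * d j) = - G i k"
    using linear_system_solvable[OF nz, of "\<lambda>i. - G i k"] by blast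
  define c where "c = d(k := 1)"
  have ck: "c k = 1" unfolding c_def by simp
  have c0: "(\<Sum>j<Suc k. G i j * c j) = 0" if "i < k" for i
    using d[OF that] unfolding c_def by simp
  have "qform (Suc k) G c = (\<Sum>i<Suc k. c i * (\<Sum>j<Suc k. G i j * c j))"
    unfolding qform_def by (simp only: sum_distrib_left mult_ac)
  also have "\<dots> = (\<Sum>j<Suc k. G k j * c j)"
    by (subst sum.lessThan_Suc) (simp del: sum.lessThan_Suc add: c0 ck)
  finally have q: "qform (Suc k) G c = (\<Sum>j<Suc k. G k j * c j)" .
  show thesis
  proof (rule that)
    show "c k = 1" by (rule ck)
    show "Determinant.det (mat_of (Suc k) G) = Determinant.det (mat_of k G) * qform (Suc k) G c"
      unfolding q using det_schur_complement[OF c0 ck] .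
  next
    fix x :: "nat \<Rightarrow> real" assume xk: "x k = 1"
    \<comment> \<open>The deviation \<open>y\<close> has last coordinate 0, whereas
      \<open>G c\<close> vanishes in all other coordinates, so the cross term of the expansion
      disappears.\<close>
    define y where "y = (\<lambda>i. x i - c i)"
    have yk: "y k = 0" unfolding y_def using xk ck by simp
    have sym: "\<And>i j. G i j = G j i" using G unfolding pos_def_upto_def by blast
    have "qform (Suc k) G (\<lambda>i. c i + y i) = qform (Suc k) G c
        + 2 * (\<Sum>i<Suc k. y i * (\<Sum>j<Suc k. G i j * c j)) + qform (Suc k) G y"
      by (rule qform_add[OF sym])
    also have "(\<Sum>i<Suc k. y i * (\<Sum>j<Suc k. G i j * c j)) = 0"
      by (subst sum.lessThan_Suc) (simp del: sum.lessThan_Suc add: c0 yk)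
    finally show "qform (Suc k) G c \<le> qform (Suc k) G x"
      using qform_nonneg[OF G, of y] unfolding y_def by simp
  qed
qed

text \<open>By induction: each ratio of consecutive leading minors is a value of the form at a
  vector with last coordinate 1.\<close>

lemma det_pos: "pos_def_upto k G \<Longrightarrow> Determinant.det (mat_of k G) > 0"
proof (induction k)
  case 0
  then show ?case by simp
next
  case (Suc k)
  have pos: "Determinant.det (mat_of k G) > 0" by (rule Suc.IH[OF pos_def_upto_mono[OF Suc.prems]])
  then have "Determinant.det (mat_of k G) \<noteq> 0" by simp
  then obtain c where c: "c k = 1"
    "Determinant.det (mat_of (Suc k) G) = Determinant.det (mat_of k G) * qform (Suc k) G c"
    using leading_minor_ratio[OF Suc.prems] by metis
  have "qform (Suc k) G c > 0"
    using Suc.prems c(1) unfolding pos_def_upto_def by (metis lessI zero_neq_one)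
  then show ?case using pos c(2) by simp
qed

lemma pos_def_solvable:
  assumes "pos_def_upto k G"
  obtains c where "\<And>i. i < k \<Longrightarrow> (\<Sum>j<k. G i j * c j) = b i"
  using linear_system_solvable[of k G b] det_pos[OF assms] by (metis less_irrefl)

lemma qform_linear: "qform k (\<lambda>i j. W i j + P i j) x = qform k W x + qform k P x"
  unfolding qform_def by (simp add: algebra_simps sum.distrib)

lemma pos_def_upto_add:
  assumes "pos_def_upto k W" "\<And>i j. P i j = P j i" "\<And>x. qform k P x \<ge> 0"
  shows "pos_def_upto k (\<lambda>i j. W i j + P i j)"
  using assms unfolding pos_def_upto_def by (auto simp: qform_linear intro!: add_pos_nonneg)

text \<open>In a positive semidefinite matrix a zero on the diagonal forces its whole row and column
  to vanish. Only the corner entry can then survive, and the form at \<open>c\<close> equals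
  it.\<close>

lemma psd_last_diag_zero:
  assumes sym: "\<And>i j. P i j = P j i" and psd: "\<And>x. qform (Suc k) P x \<ge> 0"
    and diag: "\<And>i. i < k \<Longrightarrow> P i i = 0" and c: "c k = 1" "qform (Suc k) P c = 0"
  shows "P k k = 0"
proof -
  have off: "P i j = 0" if ij: "i < Suc k" "j < k" "i \<noteq> j" for i j
  proof (rule ccontr)
    assume nz: "P i j \<noteq> 0"
    \<comment> \<open>At the vector with entry 1 at \<open>i\<close> and \<open>t\<close> at
      \<open>j\<close>, the form is \<open>P i i + 2 * t * P i j\<close>, since
      \<open>P j j = 0\<close>; this \<open>t\<close> makes it -1.\<close>
    define t where "t = - (P i i + 1) / (2 * P i j)"
    define x where "x = (\<lambda>m. (if m = i then 1 else 0) + (if m = j then t else 0 :: real))"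
    have "qform (Suc k) P x = qform (Suc k) P (\<lambda>m. if m = i then 1 else 0)
      + 2 * (\<Sum>a<Suc k. (if a = j then t else 0) * (\<Sum>b<Suc k. P a b * (if b = i then 1 else 0)))
      + qform (Suc k) P (\<lambda>m. if m = j then t else 0)"
      unfolding x_def by (rule qform_add[OF sym])
    also have "qform (Suc k) P (\<lambda>m. if m = i then 1 else 0) = P i i"
      unfolding qform_def using ij
      by (simp del: sum.lessThan_Suc add: if_distrib[of "\<lambda>z. z * _"] if_distrib[of "\<lambda>z. _ * z"] cong: if_cong)
    also have "qform (Suc k) P (\<lambda>m. if m = j then t else 0) = t * t * P j j"
      unfolding qform_def using ij
      by (simp del: sum.lessThan_Suc add: if_distrib[of "\<lambda>z. z * _"] if_distrib[of "\<lambda>z. _ * z"] cong: if_cong)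
    also have "(\<Sum>a<Suc k. (if a = j then t else 0) * (\<Sum>b<Suc k. P a b * (if b = i then 1 else 0))) = t * P j i"
      using ij
      by (simp del: sum.lessThan_Suc add: if_distrib[of "\<lambda>z. z * _"] if_distrib[of "\<lambda>z. _ * z"] cong: if_cong)
    also have "P i i + 2 * (t * P j i) + t * t * P j j = -1"
      using nz diag[of j] ij unfolding sym[of j i] t_def by (simp add: field_simps)
    finally show False using psd[of x] by simp
  qed
  have z: "P i j = 0" if "i < Suc k" "j < Suc k" "\<not> (i = k \<and> j = k)" for i j
    using off[of i j] off[of j i] diag[of i] sym[of i j] that by (cases "i = j") (auto simp: less_Suc_eq)
  have "qform (Suc k) P c = (\<Sum>i<Suc k. \<Sum>j<Suc k. if i = k \<and> j = k then P k k else 0)"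
    unfolding qform_def using z c(1) by (intro sum.cong refl) auto
  also have "\<dots> = P k k" by simp
  finally show ?thesis using c(2) by simp
qed

text \<open>Evaluating the form of \<open>W + P\<close> at its own minimiser bounds each ratio of consecutive
  leading minors from below by the corresponding ratio for \<open>W\<close>.\<close>

lemma det_add_psd:
  assumes "pos_def_upto k W" "\<And>i j. P i j = P j i" "\<And>x. qform k P x \<ge> 0"
  shows "Determinant.det (mat_of k W) \<le> Determinant.det (mat_of k (\<lambda>i j. W i j + P i j)) \<and>
    (Determinant.det (mat_of k (\<lambda>i j. W i j + P i j)) = Determinant.det (mat_of k W) \<longrightarrow> (\<forall>i<k. P i i = 0))"
  using assms
proof (induction k)
  case 0
  then show ?case by simp
next
  case (Suc k)
  let ?V = "\<lambda>i j. W i j + P i j"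
  have Wk: "pos_def_upto k W" by (rule pos_def_upto_mono[OF Suc.prems(1)])
  have Pk: "qform k P x \<ge> 0" for x
  proof -
    have "qform (Suc k) P (x(k := 0)) = qform k P (x(k := 0))" by (rule qform_Suc_restrict) simp
    also have "\<dots> = qform k P x" by (rule qform_cong) simp
    finally show ?thesis using Suc.prems(3)[of "x(k := 0)"] by (simp del: fun_upd_apply)
  qed
  have V: "pos_def_upto (Suc k) ?V" by (rule pos_def_upto_add[OF Suc.prems])
  note IH = Suc.IH[OF Wk Suc.prems(2) Pk]
  have dW: "Determinant.det (mat_of k W) > 0" by (rule det_pos[OF Wk])
  have dV: "Determinant.det (mat_of k ?V) > 0" by (rule det_pos[OF pos_def_upto_mono[OF V]])
  obtain c where c: "c k = 1"
    "Determinant.det (mat_of (Suc k) W) = Determinant.det (mat_of k W) * qform (Suc k) W c"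
    "\<And>x. x k = 1 \<Longrightarrow> qform (Suc k) W c \<le> qform (Suc k) W x"
    using leading_minor_ratio[OF Suc.prems(1) less_imp_neq[OF dW, symmetric]] by blast
  obtain e where e: "e k = 1"
    "Determinant.det (mat_of (Suc k) ?V) = Determinant.det (mat_of k ?V) * qform (Suc k) ?V e"
    using leading_minor_ratio[OF V less_imp_neq[OF dV, symmetric]] by blast
  have qc: "qform (Suc k) W c > 0"
    using Suc.prems(1) c(1) unfolding pos_def_upto_def by (metis lessI zero_neq_one)
  have P0: "qform (Suc k) P e \<ge> 0" by (rule Suc.prems(3))
  have le: "qform (Suc k) W c \<le> qform (Suc k) W e" using c(3)[of e] e(1) by blast
  have qe: "qform (Suc k) ?V e = qform (Suc k) W e + qform (Suc k) P e" by (rule qform_linear)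
  have q: "qform (Suc k) W c \<le> qform (Suc k) ?V e" using P0 le qe by linarith
  have d: "Determinant.det (mat_of k W) \<le> Determinant.det (mat_of k ?V)" using IH by blast
  have "Determinant.det (mat_of (Suc k) W) \<le> Determinant.det (mat_of (Suc k) ?V)"
    unfolding c(2) e(2) by (rule mult_mono[OF d q]) (use dV qc in auto)
  moreover have "\<forall>i<Suc k. P i i = 0"
    if eq: "Determinant.det (mat_of (Suc k) ?V) = Determinant.det (mat_of (Suc k) W)"
  proof -
    have eq': "Determinant.det (mat_of k ?V) * qform (Suc k) ?V e = Determinant.det (mat_of k W) * qform (Suc k) W c"
      using eq unfolding c(2) e(2) .
    \<comment> \<open>Equality case: both products have positive factors, and each factor for
      \<open>W + P\<close> is at least its counterpart for \<open>W\<close>. Equal products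
      therefore force equal factors.\<close>
    have "Determinant.det (mat_of k ?V) * qform (Suc k) W c \<le> Determinant.det (mat_of k W) * qform (Suc k) W c"
      unfolding eq'[symmetric] using q dV by simp
    then have deq: "Determinant.det (mat_of k ?V) = Determinant.det (mat_of k W)"
      using qc d by simp
    then have "qform (Suc k) ?V e = qform (Suc k) W c" using eq' dW by simp
    then have Pe: "qform (Suc k) P e = 0" using qe le P0 by linarith
    have diag: "P i i = 0" if "i < k" for i using IH deq that by blast
    have "P k k = 0" using psd_last_diag_zero[of P k e] Suc.prems(2,3) diag e(1) Pe by blast
    then show ?thesis using diag by (auto simp: less_Suc_eq)
  qed
  ultimately show ?case by blast
qed

section \<open>Linear independence of order statistics\<close>

text \<open>A single point is Lebesgue null, hence null for every law with a Lebesgue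
  density.\<close>

lemma (in prob_space) AE_distributed_lborel_neq:
  assumes "distributed M lborel Z g"
  shows "AE \<omega> in M. Z \<omega> \<noteq> a"
proof -
  have [measurable]: "Z \<in> borel_measurable M" using distributed_measurable[OF assms] by simp
  have [measurable]: "g \<in> borel_measurable lborel" using distributed_borel_measurable[OF assms] .
  have "AE x in density lborel g. x \<noteq> a"
    by (subst AE_density) (auto intro: AE_mp[OF AE_lborel_singleton[of a]])
  then have "AE x in distr M lborel Z. x \<noteq> a"
    unfolding distributed_distr_eq_density[OF assms] .
  then show ?thesis by (subst (asm) AE_distr_iff) auto
qed

text \<open>Given \<open>V = v\<close>, the sum vanishes only if \<open>U = -v\<close>, a null event
  by assumption; Fubini on the product of the two laws finishes. Nothing is required of the law of
  \<open>V\<close>.\<close>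

lemma (in prob_space) AE_indep_sum_neq_0:
  fixes U V :: "'a \<Rightarrow> real"
  assumes ind: "indep_var borel U borel V" and U: "\<And>a. AE \<omega> in M. U \<omega> \<noteq> a"
  shows "AE \<omega> in M. U \<omega> + V \<omega> \<noteq> 0"
proof -
  have [measurable]: "U \<in> borel_measurable M" "V \<in> borel_measurable M"
    using indep_var_rv1[OF ind] indep_var_rv2[OF ind] by auto
  interpret DU: prob_space "distr M borel U" by (rule prob_space_distr) simp
  interpret DV: prob_space "distr M borel V" by (rule prob_space_distr) simp
  interpret P: pair_sigma_finite "distr M borel U" "distr M borel V" ..
  have "(\<lambda>x. fst x + snd x) \<in> borel_measurable (borel \<Otimes>\<^sub>M (borel :: real measure))"
    by measurable
  from measurable_sets[OF this, of "- {0}"]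
  have neq: "{x \<in> space (distr M borel U \<Otimes>\<^sub>M distr M borel V). fst x + snd x \<noteq> 0}
      \<in> sets (distr M borel U \<Otimes>\<^sub>M distr M borel V)"
    by (simp add: space_pair_measure vimage_def cong: sets_pair_measure_cong)
  have U': "AE u in distr M borel U. u \<noteq> a" for a
    using U[of a] by (subst AE_distr_iff) auto
  \<comment> \<open>The null sections are those in \<open>u\<close> for fixed \<open>v\<close>, so
    \<open>v\<close> is quantified outside first and the order is exchanged afterwards.\<close>
  have "AE v in distr M borel V. AE u in distr M borel U. u + v \<noteq> 0"
  proof (rule AE_I2)
    fix v show "AE u in distr M borel U. u + v \<noteq> 0"
      using U'[of "- v"] by (rule AE_mp) (auto simp: eq_neg_iff_add_eq_0)
  qed
  then have "AE u in distr M borel U. AE v in distr M borel V. u + v \<noteq> 0"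
    by (subst P.AE_commute[OF neq]) auto
  then have "AE x in distr M borel U \<Otimes>\<^sub>M distr M borel V. fst x + snd x \<noteq> 0"
    by (subst (asm) P.AE_pair_iff[OF neq])
  then have "AE x in distr M (borel \<Otimes>\<^sub>M borel) (\<lambda>\<omega>. (U \<omega>, V \<omega>)). fst x + snd x \<noteq> 0"
    using indep_var_distribution_eq[THEN iffD1, OF ind] by argo
  then show ?thesis by (subst (asm) AE_distr_iff) auto
qed

text \<open>The term with index \<open>k\<close> is atomless and independent of the sum of all other
  terms, so one nonzero coefficient is enough.\<close>

lemma (in prob_space) AE_indep_lincomb_neq_0:
  fixes Z :: "'i \<Rightarrow> 'a \<Rightarrow> real"
  assumes fin: "finite I" and ind: "indep_vars (\<lambda>_. borel) Z I"
    and Z: "\<And>i a. i \<in> I \<Longrightarrow> AE \<omega> in M. Z i \<omega> \<noteq> a"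
    and k: "k \<in> I" "w k \<noteq> 0"
  shows "AE \<omega> in M. (\<Sum>i\<in>I. w i * Z i \<omega>) \<noteq> 0"
proof -
  have "indep_vars (\<lambda>_. borel) (\<lambda>i \<omega>. w i * Z i \<omega>) (insert k (I - {k}))"
    using indep_vars_compose2[OF ind, of "\<lambda>i x. w i * x" "\<lambda>_. borel"] k
    by (simp add: insert_absorb)
  then have 1: "indep_var borel (\<lambda>\<omega>. w k * Z k \<omega>) borel (\<lambda>\<omega>. \<Sum>i\<in>I - {k}. w i * Z i \<omega>)"
    using fin by (intro indep_vars_sum) auto
  have 2: "AE \<omega> in M. w k * Z k \<omega> \<noteq> a" for a
    using Z[OF k(1), of "a / w k"] by (rule AE_mp) (use k(2) in auto)
  show ?thesis using AE_indep_sum_neq_0[OF 1 2] by (simp add: sum.remove[OF fin k(1)])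
qed

section \<open>Order statistics as rearrangements of the sample\<close>

definition orderings :: "nat \<Rightarrow> nat list set" where
  "orderings n = {L. mset L = mset [1..<Suc n]}"

lemma finite_orderings: "finite (orderings n)"
proof (rule finite_subset)
  show "orderings n \<subseteq> {L. set L \<subseteq> {1..n} \<and> length L = n}"
  proof
    fix L assume "L \<in> orderings n"
    then have L: "mset L = mset [1..<Suc n]" unfolding orderings_def by simp
    show "L \<in> {L. set L \<subseteq> {1..n} \<and> length L = n}"
      using mset_eq_setD[OF L] mset_eq_length[OF L] by auto
  qed
  show "finite {L. set L \<subseteq> {1..n} \<and> length L = n}" by (rule finite_lists_length_eq) simp
qed

lemma orderingsD:
  assumes "L \<in> orderings n"
  shows "length L = n" "distinct L" "set L = {1..n}"
proof -
  have L: "mset L = mset [1..<Suc n]" using assms unfolding orderings_def by simp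
  show "length L = n" using mset_eq_length[OF L] by simp
  show "distinct L" using mset_eq_imp_distinct_iff[OF L] by simp
  show "set L = {1..n}" using mset_eq_setD[OF L] by auto
qed

lemma ex_ordering: "\<exists>L\<in>orderings n. sorted (map (\<lambda>j. Y j \<omega>) L)"
  by (rule bexI[of _ "sort_key (\<lambda>j. Y j \<omega>) [1..<Suc n]"]) (auto simp: orderings_def simp del: upt_Suc)

text \<open>A sorted list is determined by its multiset. With ties several lists \<open>L\<close>
  sort the sample, but all give the same values, so ties need no separate treatment.\<close>

lemma order_stat_ordering:
  assumes "L \<in> orderings n" "sorted (map (\<lambda>j. Y j \<omega>) L)" "i < n"
  shows "order_stat n Y (Suc i) \<omega> = Y (L ! i) \<omega>"
proof -
  have "sort (map (\<lambda>j. Y j \<omega>) [1..<Suc n]) = map (\<lambda>j. Y j \<omega>) L"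
    by (rule properties_for_sort) (use assms in \<open>auto simp: orderings_def simp del: upt_Suc\<close>)
  then show ?thesis unfolding order_stat_def using assms orderingsD(1)[OF assms(1)] by simp
qed

text \<open>The events that a given list sorts the sample form a finite cover of the space, and on
  each of them the order statistic is a single sample variable.\<close>

lemma order_stat_measurable:
  assumes Y: "\<And>j. j \<in> {1..n} \<Longrightarrow> Y j \<in> borel_measurable M" and i: "i \<in> {1..n}"
  shows "order_stat n Y i \<in> borel_measurable M"
proof (rule measurable_piecewise_restrict)
  let ?A = "\<lambda>L. {\<omega>\<in>space M. sorted (map (\<lambda>j. Y j \<omega>) L)}"
  show "countable (?A ` orderings n)" by (intro countable_finite finite_imageI finite_orderings)
  show "space M \<subseteq> \<Union> (?A ` orderings n)" using ex_ordering[of n Y] by auto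
  fix A assume "A \<in> ?A ` orderings n"
  then obtain L where L: "L \<in> orderings n" "A = ?A L" by auto
  note LD = orderingsD[OF L(1)]
  have m: "Y (L ! p) \<in> borel_measurable M" if "p < n" for p
    using LD that by (intro Y) (metis nth_mem)
  \<comment> \<open>Sortedness amounts to finitely many comparisons of two measurable
    functions.\<close>
  have "A = {\<omega>\<in>space M. \<forall>p\<in>{..<n}. \<forall>q\<in>{..<p}. Y (L ! q) \<omega> \<le> Y (L ! p) \<omega>}"
    unfolding L(2) using LD(1) by (auto simp: sorted_wrt_iff_nth_less)
  also have "\<dots> \<in> sets M"
    by (intro sets.sets_Collect_finite_All' sets.sets_Collect_finite_All borel_measurable_le m) auto
  finally show "A \<inter> space M \<in> sets M" by auto
  have "Y (L ! (i - 1)) \<in> borel_measurable M" using i by (intro m) auto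
  then have "Y (L ! (i - 1)) \<in> borel_measurable (restrict_space M A)"
    by (rule measurable_restrict_space1)
  also have "?this \<longleftrightarrow> order_stat n Y i \<in> borel_measurable (restrict_space M A)"
  proof (rule measurable_cong)
    fix \<omega> assume "\<omega> \<in> space (restrict_space M A)"
    then have "sorted (map (\<lambda>j. Y j \<omega>) L)" unfolding L(2) space_restrict_space by auto
    from order_stat_ordering[of L n Y \<omega> "i - 1", OF L(1) this] i
    show "Y (L ! (i - 1)) \<omega> = order_stat n Y i \<omega>" by auto
  qed
  finally show "order_stat n Y i \<in> borel_measurable (restrict_space M A)" .
qed

text \<open>For each of the finitely many orderings of the sample, a linear combination of the order
  statistics agrees with a linear combination of the independent, atomless sample variables.\<close>

lemma (in prob_space) AE_order_stat_lincomb_neq_0: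
  assumes ind: "indep_vars (\<lambda>_. borel) Y {1..n}"
    and Y: "\<And>j a. j \<in> {1..n} \<Longrightarrow> AE \<omega> in M. Y j \<omega> \<noteq> a"
    and k: "k \<in> {1..n}" "w k \<noteq> 0"
  shows "AE \<omega> in M. (\<Sum>j = 1..n. w j * order_stat n Y j \<omega>) \<noteq> 0"
proof -
  have shift: "(\<Sum>j = 1..n. h j) = (\<Sum>i<n. h (Suc i))" for h :: "nat \<Rightarrow> real"
    by (simp add: sum.atLeast1_atMost_eq)
  have "AE \<omega> in M. (\<Sum>i<n. w (Suc i) * Y (L ! i) \<omega>) \<noteq> 0" if L: "L \<in> orderings n" for L
  proof -
    note LD = orderingsD[OF L]
    have bij: "bij_betw (\<lambda>i. L ! i) {..<n} {1..n}"
      using LD by (intro bij_betw_nth) auto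
    \<comment> \<open>The coefficients carried over from ranks to sample indices: the variable at
      position \<open>i\<close> of \<open>L\<close> gets the coefficient of rank
      \<open>Suc i\<close>.\<close>
    define v where "v = (\<lambda>j. w (Suc (inv_into {..<n} (\<lambda>i. L ! i) j)))"
    have v: "v (L ! i) = w (Suc i)" if "i < n" for i
      unfolding v_def using bij_betw_inv_into_left[OF bij, of i] that by simp
    have "(\<Sum>i<n. w (Suc i) * Y (L ! i) \<omega>) = (\<Sum>j = 1..n. v j * Y j \<omega>)" for \<omega>
      using sum.reindex_bij_betw[OF bij, of "\<lambda>j. v j * Y j \<omega>"] by (simp add: v)
    moreover have "AE \<omega> in M. (\<Sum>j = 1..n. v j * Y j \<omega>) \<noteq> 0"
    proof (rule AE_indep_lincomb_neq_0[OF _ ind Y])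
      have "k - 1 < n" "Suc (k - 1) = k" using k by auto
      then show "L ! (k - 1) \<in> {1..n}" "v (L ! (k - 1)) \<noteq> 0"
        using bij_betwE[OF bij] k v[of "k - 1"] by auto
    qed auto
    ultimately show ?thesis by simp
  qed
  \<comment> \<open>The list that sorts the sample varies with the outcome, so the exceptional null
    sets of all lists are united; there are finitely many.\<close>
  then have "AE \<omega> in M. \<forall>L\<in>orderings n. (\<Sum>i<n. w (Suc i) * Y (L ! i) \<omega>) \<noteq> 0"
    by (intro AE_finite_allI finite_orderings)
  then show ?thesis
  proof (rule AE_mp, intro AE_I2 impI)
    fix \<omega> assume *: "\<forall>L\<in>orderings n. (\<Sum>i<n. w (Suc i) * Y (L ! i) \<omega>) \<noteq> 0"
    obtain L where L: "L \<in> orderings n" "sorted (map (\<lambda>j. Y j \<omega>) L)" using ex_ordering[of n Y \<omega>] by blast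
    have "(\<Sum>j = 1..n. w j * order_stat n Y j \<omega>) = (\<Sum>i<n. w (Suc i) * Y (L ! i) \<omega>)"
      unfolding shift by (intro sum.cong refl) (simp add: order_stat_ordering[of L n Y \<omega>] L)
    then show "(\<Sum>j = 1..n. w j * order_stat n Y j \<omega>) \<noteq> 0" using * L by simp
  qed
qed

section \<open>Best linear prediction from linearly independent variables\<close>

definition square_integrable :: "'a measure \<Rightarrow> ('a \<Rightarrow> real) \<Rightarrow> bool" where
  "square_integrable M U \<longleftrightarrow> U \<in> borel_measurable M \<and> integrable M (\<lambda>\<omega>. (U \<omega>)\<^sup>2)"

text \<open>The product is dominated by the sum of the two squares, because the square of
  \<open>\<bar>U\<bar> - \<bar>V\<bar>\<close> is nonnegative.\<close>

lemma square_integrable_mult: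
  assumes "square_integrable M U" "square_integrable M V"
  shows "integrable M (\<lambda>\<omega>. U \<omega> * V \<omega>)"
proof (rule Bochner_Integration.integrable_bound)
  show "integrable M (\<lambda>\<omega>. (U \<omega>)\<^sup>2 + (V \<omega>)\<^sup>2)"
    using assms unfolding square_integrable_def by auto
  show "(\<lambda>\<omega>. U \<omega> * V \<omega>) \<in> borel_measurable M"
    using assms unfolding square_integrable_def by auto
  show "AE \<omega> in M. norm (U \<omega> * V \<omega>) \<le> norm ((U \<omega>)\<^sup>2 + (V \<omega>)\<^sup>2)"
  proof (rule AE_I2)
    fix \<omega>
    have "2 * (\<bar>U \<omega>\<bar> * \<bar>V \<omega>\<bar>) \<le> (U \<omega>)\<^sup>2 + (V \<omega>)\<^sup>2"
      using zero_le_power2[of "\<bar>U \<omega>\<bar> - \<bar>V \<omega>\<bar>"] by (simp add: power2_diff)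
    moreover have "0 \<le> \<bar>U \<omega>\<bar> * \<bar>V \<omega>\<bar>" by simp
    ultimately have "\<bar>U \<omega>\<bar> * \<bar>V \<omega>\<bar> \<le> (U \<omega>)\<^sup>2 + (V \<omega>)\<^sup>2" by linarith
    then show "norm (U \<omega> * V \<omega>) \<le> norm ((U \<omega>)\<^sup>2 + (V \<omega>)\<^sup>2)" by (simp add: abs_mult)
  qed
qed

lemma square_integrable_0: "square_integrable M (\<lambda>_. 0)"
  unfolding square_integrable_def by simp

lemma square_integrable_cmult: "square_integrable M U \<Longrightarrow> square_integrable M (\<lambda>\<omega>. c * U \<omega>)"
  unfolding square_integrable_def by (auto simp: power_mult_distrib)

lemma square_integrable_add:
  assumes "square_integrable M U" "square_integrable M V"
  shows "square_integrable M (\<lambda>\<omega>. U \<omega> + V \<omega>)"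
proof -
  have "integrable M (\<lambda>\<omega>. (U \<omega>)\<^sup>2 + (V \<omega>)\<^sup>2 + 2 * (U \<omega> * V \<omega>))"
    using assms square_integrable_mult[OF assms] unfolding square_integrable_def
    by (intro Bochner_Integration.integrable_add integrable_mult_right) auto
  then show ?thesis using assms unfolding square_integrable_def
    by (auto simp: power2_sum mult.assoc)
qed

lemma square_integrable_sum:
  "(\<And>i. i \<in> I \<Longrightarrow> square_integrable M (U i)) \<Longrightarrow> square_integrable M (\<lambda>\<omega>. \<Sum>i\<in>I. U i \<omega>)"
proof (induction I rule: infinite_finite_induct)
  case (insert i I)
  then show ?case using square_integrable_add[of M "U i" "\<lambda>\<omega>. \<Sum>i\<in>I. U i \<omega>"] by simp
qed (auto simp: square_integrable_0)

abbreviation gram :: "'a measure \<Rightarrow> (nat \<Rightarrow> 'a \<Rightarrow> real) \<Rightarrow> nat \<Rightarrow> nat \<Rightarrow> real" where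
  "gram M U \<equiv> \<lambda>i j. LINT \<omega>|M. U i \<omega> * U j \<omega>"

text \<open>The bridge from determinants to \<open>L\<^sup>2\<close>: it makes Gram matrices
  positive semidefinite, and definite once no nontrivial combination has zero second moment.\<close>

lemma qform_gram:
  assumes "\<And>i. i < k \<Longrightarrow> square_integrable M (U i)"
  shows "qform k (gram M U) x = (LINT \<omega>|M. (\<Sum>i<k. x i * U i \<omega>)\<^sup>2)"
proof -
  have int: "integrable M (\<lambda>\<omega>. x i * x j * (U i \<omega> * U j \<omega>))" if "i < k" "j < k" for i j
    by (intro integrable_mult_right square_integrable_mult assms that)
  have "(LINT \<omega>|M. (\<Sum>i<k. x i * U i \<omega>)\<^sup>2) = (LINT \<omega>|M. (\<Sum>i<k. \<Sum>j<k. x i * x j * (U i \<omega> * U j \<omega>)))"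
    by (simp add: power2_eq_square sum_product mult_ac)
  also have "\<dots> = (\<Sum>i<k. LINT \<omega>|M. (\<Sum>j<k. x i * x j * (U i \<omega> * U j \<omega>)))"
    using int by (intro Bochner_Integration.integral_sum Bochner_Integration.integrable_sum) auto
  also have "\<dots> = (\<Sum>i<k. \<Sum>j<k. LINT \<omega>|M. x i * x j * (U i \<omega> * U j \<omega>))"
    using int by (intro sum.cong refl Bochner_Integration.integral_sum) auto
  also have "\<dots> = qform k (gram M U) x"
    unfolding qform_def by simp
  finally show ?thesis by simp
qed

lemma minus_vec_eq_0:
  fixes a b :: "real Matrix.vec"
  assumes "a \<in> carrier_vec r" "b \<in> carrier_vec r" "a - b = 0\<^sub>v r"
  shows "a = b"
proof (rule eq_vecI)
  fix i assume "i < dim_vec b"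
  then have i: "i < r" using assms by simp
  have "vec_index (a - b) i = 0" unfolding assms(3) using i by simp
  then show "vec_index a i = vec_index b i" using assms(1,2) i by simp
qed (use assms in simp)

text \<open>Isolates what prediction needs to know about order statistics. The second assumption is
  linear independence in a strong form: a nontrivial combination is almost surely nonzero, not
  merely nonzero with positive probability.\<close>

locale lin_indep_variables = prob_space M for M :: "'a measure" +
  fixes X :: "nat \<Rightarrow> 'a \<Rightarrow> real" and n :: nat
  assumes X_L2: "j \<in> {1..n} \<Longrightarrow> square_integrable M (X j)"
    and X_lincomb_neq_0: "k \<in> {1..n} \<Longrightarrow> w k \<noteq> 0 \<Longrightarrow> AE \<omega> in M. (\<Sum>j = 1..n. w j * X j \<omega>) \<noteq> 0"
begin

definition lincomb :: "(nat \<Rightarrow> real) \<Rightarrow> 'a \<Rightarrow> real" where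
  "lincomb w \<omega> = (\<Sum>j = 1..n. w j * X j \<omega>)"

lemma lincomb_L2: "square_integrable M (lincomb w)"
  unfolding lincomb_def by (intro square_integrable_sum square_integrable_cmult X_L2)

lemma lincomb_square_pos:
  assumes "k \<in> {1..n}" "w k \<noteq> 0"
  shows "(LINT \<omega>|M. (lincomb w \<omega>)\<^sup>2) > 0"
proof -
  have int: "integrable M (\<lambda>\<omega>. (lincomb w \<omega>)\<^sup>2)"
    using lincomb_L2 unfolding square_integrable_def by blast
  have "(LINT \<omega>|M. (lincomb w \<omega>)\<^sup>2) \<noteq> 0"
  proof
    assume "(LINT \<omega>|M. (lincomb w \<omega>)\<^sup>2) = 0"
    then have "AE \<omega> in M. (lincomb w \<omega>)\<^sup>2 = 0"
      using integral_nonneg_eq_0_iff_AE[OF int] by simp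
    with X_lincomb_neq_0[of k w, OF assms] have "AE \<omega> in M. False"
      unfolding lincomb_def by eventually_elim simp
    then show False using AE_False by simp
  qed
  moreover have "(LINT \<omega>|M. (lincomb w \<omega>)\<^sup>2) \<ge> 0" by simp
  ultimately show ?thesis by linarith
qed

text \<open>The second premise is linear independence of the coefficient vectors \<open>v i\<close>.
  The form at \<open>x\<close> is then the second moment of a combination with some nonzero
  coefficient.\<close>

lemma gram_lincomb_pos_def:
  assumes U: "\<And>i. i < k \<Longrightarrow> U i = lincomb (v i)"
    and v: "\<And>x i. i < k \<Longrightarrow> x i \<noteq> 0 \<Longrightarrow> \<exists>m\<in>{1..n}. (\<Sum>i<k. x i * v i m) \<noteq> 0"
  shows "pos_def_upto k (gram M U)"
  unfolding pos_def_upto_def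
proof (intro conjI allI impI)
  show "gram M U i j = gram M U j i" for i j by (simp add: mult.commute)
  fix x :: "nat \<Rightarrow> real" assume "\<exists>i<k. x i \<noteq> 0"
  then obtain m where m: "m \<in> {1..n}" "(\<Sum>i<k. x i * v i m) \<noteq> 0" using v by blast
  have "(\<Sum>i<k. x i * U i \<omega>) = lincomb (\<lambda>m. \<Sum>i<k. x i * v i m) \<omega>" for \<omega>
    unfolding lincomb_def sum_distrib_right by (subst sum.swap) (simp add: U lincomb_def sum_distrib_left mult.assoc)
  then have "qform k (gram M U) x = (LINT \<omega>|M. (lincomb (\<lambda>m. \<Sum>i<k. x i * v i m) \<omega>)\<^sup>2)"
    by (subst qform_gram) (auto simp: U lincomb_L2)
  also have "\<dots> > 0" using lincomb_square_pos[of m "\<lambda>m. \<Sum>i<k. x i * v i m"] m by blast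
  finally show "qform k (gram M U) x > 0" .
qed

section \<open>Prediction from the first r variables\<close>

context
  fixes r :: nat
  assumes r: "r < n"
begin

abbreviation obs :: "real Matrix.vec \<Rightarrow> 'a \<Rightarrow> real" where
  "obs d \<omega> \<equiv> scalar_prod d (obs_vec X r \<omega>)"

text \<open>Shifts the 0-based vector to the 1-based variables and pads it with zeros beyond
  \<open>r\<close>, so that observations and prediction errors are both instances of
  \<open>lincomb\<close>.\<close>

definition obs_coef :: "real Matrix.vec \<Rightarrow> nat \<Rightarrow> real" where
  "obs_coef d m = (if 1 \<le> m \<and> m \<le> r then vec_index d (m - 1) else 0)"

lemma obs_sum: "obs d \<omega> = (\<Sum>i<r. vec_index d i * X (Suc i) \<omega>)"
  unfolding obs_vec_def scalar_prod_def by (simp add: atLeast0LessThan)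

lemma obs_lincomb: "obs d = lincomb (obs_coef d)"
proof
  fix \<omega>
  have "lincomb (obs_coef d) \<omega> = (\<Sum>m = 1..r. vec_index d (m - 1) * X m \<omega>)"
    unfolding lincomb_def using r
    by (intro sum.mono_neutral_cong_right) (auto simp: obs_coef_def)
  also have "\<dots> = obs d \<omega>" unfolding obs_sum by (simp add: sum.atLeast1_atMost_eq)
  finally show "obs d \<omega> = lincomb (obs_coef d) \<omega>" by simp
qed

lemma obs_L2: "square_integrable M (obs d)"
  unfolding obs_lincomb by (rule lincomb_L2)

lemma pred_err_lincomb:
  assumes "k \<in> {1..n}"
  shows "pred_err X r k a = lincomb (\<lambda>m. obs_coef a m - (if m = k then 1 else 0))"
proof
  fix \<omega>
  have "(\<Sum>j = 1..n. (if j = k then 1 else 0) * X j \<omega>) = (\<Sum>j = 1..n. if j = k then X j \<omega> else 0)"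
    by (rule sum.cong) auto
  also have "\<dots> = X k \<omega>" using assms by simp
  finally show "pred_err X r k a \<omega> = lincomb (\<lambda>m. obs_coef a m - (if m = k then 1 else 0)) \<omega>"
    unfolding pred_err_def fun_cong[OF obs_lincomb] by (simp add: lincomb_def left_diff_distrib sum_subtractf)
qed

lemma pred_err_L2: "k \<in> {1..n} \<Longrightarrow> square_integrable M (pred_err X r k a)"
  by (simp add: pred_err_lincomb lincomb_L2)

lemma obs_square_pos:
  assumes "d \<in> carrier_vec r" "d \<noteq> 0\<^sub>v r"
  shows "(LINT \<omega>|M. (obs d \<omega>)\<^sup>2) > 0"
proof -
  obtain i where i: "i < r" "vec_index d i \<noteq> 0" using assms by (metis carrier_vecD eq_vecI index_zero_vec)
  show ?thesis unfolding fun_cong[OF obs_lincomb]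
    by (rule lincomb_square_pos[of "Suc i"]) (use i r in \<open>auto simp: obs_coef_def\<close>)
qed

text \<open>A solution of the normal equations. They involve raw second moments rather than
  covariances, since the predictors are linear without a constant term.\<close>

definition best :: "nat \<Rightarrow> real Matrix.vec" where
  "best k = Matrix.vec r (SOME c. \<forall>i<r. (\<Sum>j<r. (LINT \<omega>|M. X (Suc i) \<omega> * X (Suc j) \<omega>) * c j) =
     (LINT \<omega>|M. X (Suc i) \<omega> * X k \<omega>))"

lemma best_carrier: "best k \<in> carrier_vec r"
  unfolding best_def by simp

text \<open>The Gram matrix of the observed variables is positive definite, so the system behind the
  choice operator in \<open>best\<close> has a solution.\<close>

lemma best_normal_equations:
  assumes "i < r"
  shows "(\<Sum>j<r. (LINT \<omega>|M. X (Suc i) \<omega> * X (Suc j) \<omega>) * vec_index (best k) j) =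
     (LINT \<omega>|M. X (Suc i) \<omega> * X k \<omega>)"
proof -
  let ?P = "\<lambda>c. \<forall>i<r. (\<Sum>j<r. (LINT \<omega>|M. X (Suc i) \<omega> * X (Suc j) \<omega>) * c j) = (LINT \<omega>|M. X (Suc i) \<omega> * X k \<omega>)"
  have "pos_def_upto r (gram M (\<lambda>i. X (Suc i)))"
  proof (rule gram_lincomb_pos_def)
    fix i assume i: "i < r"
    have "(\<Sum>m = 1..n. (if m = Suc i then 1 else 0) * X m \<omega>) = (\<Sum>m = 1..n. if m = Suc i then X m \<omega> else 0)" for \<omega>
      by (rule sum.cong) auto
    then show "X (Suc i) = lincomb (\<lambda>m. if m = Suc i then 1 else 0)"
      using i r unfolding lincomb_def by (auto simp: fun_eq_iff)
  next
    fix x :: "nat \<Rightarrow> real" and i assume i: "i < r" "x i \<noteq> 0"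
    have "(\<Sum>j<r. x j * (if Suc i = Suc j then 1 else 0)) = (\<Sum>j<r. if j = i then x j else 0)"
      by (rule sum.cong) auto
    then show "\<exists>m\<in>{1..n}. (\<Sum>j<r. x j * (if m = Suc j then 1 else 0)) \<noteq> 0"
      using i r by (intro bexI[of _ "Suc i"]) auto
  qed
  then obtain c where "\<And>i. i < r \<Longrightarrow> (\<Sum>j<r. gram M (\<lambda>i. X (Suc i)) i j * c j) = (LINT \<omega>|M. X (Suc i) \<omega> * X k \<omega>)"
    using pos_def_solvable[of r "gram M (\<lambda>i. X (Suc i))" "\<lambda>i. LINT \<omega>|M. X (Suc i) \<omega> * X k \<omega>"] by blast
  then have "?P c" by blast
  then have "?P (SOME c. ?P c)" by (rule someI[where P = ?P])
  then have "(\<Sum>j<r. (LINT \<omega>|M. X (Suc i) \<omega> * X (Suc j) \<omega>) * (SOME c. ?P c) j) = (LINT \<omega>|M. X (Suc i) \<omega> * X k \<omega>)"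
    using assms by blast
  moreover have "vec_index (best k) j = (SOME c. ?P c) j" if "j < r" for j
    unfolding best_def using that by simp
  ultimately show ?thesis by simp
qed

text \<open>The normal equations express orthogonality of the error to each single observation;
  linearity extends it to all their combinations.\<close>

lemma obs_orthogonal_best:
  assumes k: "k \<in> {1..n}"
  shows "(LINT \<omega>|M. obs d \<omega> * pred_err X r k (best k) \<omega>) = 0"
proof -
  have X: "square_integrable M (X (Suc i))" if "i < r" for i using X_L2 r that by auto
  have 1: "(LINT \<omega>|M. X (Suc i) \<omega> * pred_err X r k (best k) \<omega>) = 0" if i: "i < r" for i
  proof -
    have int: "integrable M (\<lambda>\<omega>. X (Suc i) \<omega> * X (Suc j) \<omega> * vec_index (best k) j)" if "j < r" for j
      by (intro integrable_mult_left square_integrable_mult X i that)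
    have "(LINT \<omega>|M. X (Suc i) \<omega> * pred_err X r k (best k) \<omega>) =
        (LINT \<omega>|M. (\<Sum>j<r. X (Suc i) \<omega> * X (Suc j) \<omega> * vec_index (best k) j) - X (Suc i) \<omega> * X k \<omega>)"
      unfolding pred_err_def obs_sum by (simp add: right_diff_distrib sum_distrib_left mult_ac)
    also have "\<dots> = (LINT \<omega>|M. (\<Sum>j<r. X (Suc i) \<omega> * X (Suc j) \<omega> * vec_index (best k) j))
        - (LINT \<omega>|M. X (Suc i) \<omega> * X k \<omega>)"
    proof (rule Bochner_Integration.integral_diff)
      show "integrable M (\<lambda>\<omega>. \<Sum>j<r. X (Suc i) \<omega> * X (Suc j) \<omega> * vec_index (best k) j)"
        by (rule Bochner_Integration.integrable_sum, rule int) simp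
      show "integrable M (\<lambda>\<omega>. X (Suc i) \<omega> * X k \<omega>)" by (intro square_integrable_mult X i X_L2 k)
    qed
    also have "(LINT \<omega>|M. (\<Sum>j<r. X (Suc i) \<omega> * X (Suc j) \<omega> * vec_index (best k) j)) =
        (\<Sum>j<r. (LINT \<omega>|M. X (Suc i) \<omega> * X (Suc j) \<omega>) * vec_index (best k) j)"
      by (subst Bochner_Integration.integral_sum, rule int) auto
    finally show ?thesis using best_normal_equations[OF i] by simp
  qed
  have int: "integrable M (\<lambda>\<omega>. vec_index d i * (X (Suc i) \<omega> * pred_err X r k (best k) \<omega>))" if "i < r" for i
    by (intro integrable_mult_right square_integrable_mult X that pred_err_L2 k)
  have "(LINT \<omega>|M. obs d \<omega> * pred_err X r k (best k) \<omega>) =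
      (LINT \<omega>|M. (\<Sum>i<r. vec_index d i * (X (Suc i) \<omega> * pred_err X r k (best k) \<omega>)))"
    unfolding obs_sum by (simp add: sum_distrib_right mult.assoc)
  also have "\<dots> = (\<Sum>i<r. LINT \<omega>|M. vec_index d i * (X (Suc i) \<omega> * pred_err X r k (best k) \<omega>))"
    using int by (intro Bochner_Integration.integral_sum) auto
  also have "\<dots> = 0" using 1 by simp
  finally show ?thesis .
qed

lemma pred_err_diff:
  assumes "a \<in> carrier_vec r" "b \<in> carrier_vec r"
  shows "pred_err X r k b \<omega> = pred_err X r k a \<omega> + obs (b - a) \<omega>"
  unfolding pred_err_def obs_sum using assms by (simp add: left_diff_distrib sum_subtractf)

text \<open>A Pythagorean identity: each error is the best error plus a function of the
  observations, and both cross terms vanish by orthogonality. Two different ranks are allowed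
  because the off-diagonal entries of the error matrix need them.\<close>

lemma pred_err_inner:
  assumes k: "k \<in> {1..n}" "k' \<in> {1..n}" and b: "b \<in> carrier_vec r" "b' \<in> carrier_vec r"
  shows "(LINT \<omega>|M. pred_err X r k b \<omega> * pred_err X r k' b' \<omega>) =
    (LINT \<omega>|M. pred_err X r k (best k) \<omega> * pred_err X r k' (best k') \<omega>) +
    (LINT \<omega>|M. obs (b - best k) \<omega> * obs (b' - best k') \<omega>)"
proof -
  let ?e = "pred_err X r k (best k)" and ?e' = "pred_err X r k' (best k')"
  let ?d = "obs (b - best k)" and ?d' = "obs (b' - best k')"
  have "(LINT \<omega>|M. pred_err X r k b \<omega> * pred_err X r k' b' \<omega>) =
    (LINT \<omega>|M. (?e \<omega> * ?e' \<omega> + ?d' \<omega> * ?e \<omega>) + (?d \<omega> * ?e' \<omega> + ?d \<omega> * ?d' \<omega>))"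
    unfolding pred_err_diff[OF best_carrier[of k] b(1)] pred_err_diff[OF best_carrier[of k'] b(2)]
    by (simp add: algebra_simps)
  also have "\<dots> = ((LINT \<omega>|M. ?e \<omega> * ?e' \<omega>) + (LINT \<omega>|M. ?d' \<omega> * ?e \<omega>)) +
     ((LINT \<omega>|M. ?d \<omega> * ?e' \<omega>) + (LINT \<omega>|M. ?d \<omega> * ?d' \<omega>))"
  proof -
    have i: "integrable M (\<lambda>\<omega>. ?e \<omega> * ?e' \<omega>)" "integrable M (\<lambda>\<omega>. ?d' \<omega> * ?e \<omega>)"
      "integrable M (\<lambda>\<omega>. ?d \<omega> * ?e' \<omega>)" "integrable M (\<lambda>\<omega>. ?d \<omega> * ?d' \<omega>)"
      by (intro square_integrable_mult pred_err_L2 obs_L2 k)+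
    show ?thesis
      by (simp only: Bochner_Integration.integral_add Bochner_Integration.integrable_add i)
  qed
  finally show ?thesis using obs_orthogonal_best k by simp
qed

text \<open>With equal ranks, \<open>pred_err_inner\<close> shows that the excess over the minimum
  is the second moment of the deviation, which is positive unless the deviation is zero.\<close>

lemma marginal_blip_iff:
  assumes k: "k \<in> {1..n}"
  shows "marginal_blip M X r k b \<longleftrightarrow> b = best k"
proof -
  let ?F = "\<lambda>b. LINT \<omega>|M. (pred_err X r k b \<omega>)\<^sup>2"
  have F: "?F c = ?F (best k) + (LINT \<omega>|M. (obs (c - best k) \<omega>)\<^sup>2)" if "c \<in> carrier_vec r" for c
    using pred_err_inner[OF k k that that] by (simp add: power2_eq_square)
  have lt: "?F (best k) < ?F c" if c: "c \<in> carrier_vec r" "c \<noteq> best k" for c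
  proof -
    have "c - best k \<in> carrier_vec r" using c best_carrier by simp
    moreover have "c - best k \<noteq> 0\<^sub>v r"
      using c minus_vec_eq_0[OF c(1) best_carrier[of k]] by blast
    ultimately have "(LINT \<omega>|M. (obs (c - best k) \<omega>)\<^sup>2) > 0" by (rule obs_square_pos)
    then show ?thesis using F[OF c(1)] by linarith
  qed
  show ?thesis
  proof
    assume "marginal_blip M X r k b"
    then show "b = best k"
      using lt[of b] best_carrier[of k] unfolding marginal_blip_def is_arg_min_def by blast
  next
    assume b: "b = best k"
    have "\<not> ?F y < ?F b" if "y \<in> carrier_vec r" for y
      using lt[OF that] b by (cases "y = best k") auto
    then show "marginal_blip M X r k b"
      using best_carrier b unfolding marginal_blip_def is_arg_min_def by blast
  qed
qed

section \<open>Simultaneous prediction of several variables\<close>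

context
  fixes s :: "nat list"
  assumes s: "distinct s" "\<And>k. k \<in> set s \<Longrightarrow> r < k \<and> k \<le> n"
begin

text \<open>The predicted ranks are distinct and exceed \<open>r\<close>. Hence the variable of rank
  \<open>s ! i\<close> occurs in the error with index \<open>i\<close>, with coefficient -1, and in
  no other error, and a combination of errors has coefficient \<open>- x i\<close> there.\<close>

lemma best_err_pos_def:
  "pos_def_upto (length s) (gram M (\<lambda>i. pred_err X r (s ! i) (best (s ! i))))"
proof (rule gram_lincomb_pos_def)
  fix i assume i: "i < length s"
  show "pred_err X r (s ! i) (best (s ! i)) =
      lincomb (\<lambda>m. obs_coef (best (s ! i)) m - (if m = s ! i then 1 else 0))"
    by (rule pred_err_lincomb) (use s(2)[OF nth_mem[OF i]] in auto)
next
  fix x :: "nat \<Rightarrow> real" and i assume i: "i < length s" "x i \<noteq> 0"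
  have si: "r < s ! i" "s ! i \<le> n" using s(2)[OF nth_mem[OF i(1)]] by auto
  have "(\<Sum>j<length s. x j * (obs_coef (best (s ! j)) (s ! i) - (if s ! i = s ! j then 1 else 0)))
      = (\<Sum>j<length s. if j = i then - x i else 0)"
    using si i nth_eq_iff_index_eq[OF s(1)] by (intro sum.cong) (auto simp: obs_coef_def)
  also have "\<dots> = - x i" using i by simp
  finally show "\<exists>m\<in>{1..n}. (\<Sum>j<length s. x j *
      (obs_coef (best (s ! j)) m - (if m = s ! j then 1 else 0))) \<noteq> 0"
    using i si by (intro bexI[of _ "s ! i"]) auto
qed

text \<open>The inequality of \<open>det_add_psd\<close> yields minimality of the marginal
  solutions, and its equality case yields uniqueness.\<close>

lemma simultaneous_blip_iff: "simultaneous_blip M X r s bs \<longleftrightarrow> bs = map best s"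
proof -
  let ?l = "length s"
  define W where "W = gram M (\<lambda>i. pred_err X r (s ! i) (best (s ! i)))"
  define P where "P = (\<lambda>cs. gram M (\<lambda>i. obs (cs ! i - best (s ! i))))"
  let ?adm = "\<lambda>cs. length cs = ?l \<and> set cs \<subseteq> carrier_vec r"
  let ?D = "\<lambda>cs. Determinant.det (mspe_matrix M X r s cs)"
  have sn: "s ! i \<in> {1..n}" if "i < ?l" for i using s(2)[OF nth_mem[OF that]] by auto
  have W: "pos_def_upto ?l W" unfolding W_def by (rule best_err_pos_def)
  have adm: "?adm (map best s)" using best_carrier by auto
  have DW: "?D (map best s) = Determinant.det (mat_of ?l W)"
    unfolding mspe_matrix_def W_def by (intro arg_cong[where f = Determinant.det] eq_matI) auto
  have DV: "?D cs = Determinant.det (mat_of ?l (\<lambda>i j. W i j + P cs i j))" if cs: "?adm cs" for cs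
  proof -
    have "cs ! i \<in> carrier_vec r" if "i < ?l" for i using cs that by (metis nth_mem subsetD)
    then show ?thesis unfolding mspe_matrix_def W_def P_def
      by (intro arg_cong[where f = Determinant.det] eq_matI) (auto intro!: pred_err_inner sn)
  qed
  have Psym: "P cs i j = P cs j i" for cs i j unfolding P_def by (simp add: mult.commute)
  have Ppsd: "qform ?l (P cs) x \<ge> 0" for cs x
    unfolding P_def by (subst qform_gram) (auto intro: obs_L2)
  note mono = det_add_psd[OF W Psym Ppsd]
  have le: "?D (map best s) \<le> ?D cs" if "?adm cs" for cs
    unfolding DW DV[OF that] using mono by blast
  have eq: "cs = map best s" if cs: "?adm cs" "?D cs = ?D (map best s)" for cs
  proof (rule nth_equalityI)
    show "length cs = length (map best s)" using cs by simp
    fix i assume "i < length cs"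
    then have i: "i < ?l" using cs by simp
    have c: "cs ! i \<in> carrier_vec r" using cs i by (metis nth_mem subsetD)
    \<comment> \<open>This diagonal entry is the second moment of the deviation in component
      \<open>i\<close>, so its vanishing forces the coefficient vectors to agree.\<close>
    have "P cs i i = 0" using mono[of cs] cs(2) i unfolding DW DV[OF cs(1)] by blast
    then have "\<not> (LINT \<omega>|M. (obs (cs ! i - best (s ! i)) \<omega>)\<^sup>2) > 0"
      unfolding P_def by (simp add: power2_eq_square)
    moreover have "cs ! i - best (s ! i) \<in> carrier_vec r" using c best_carrier by simp
    ultimately have "cs ! i - best (s ! i) = 0\<^sub>v r" using obs_square_pos by blast
    then have "cs ! i = best (s ! i)"
      using minus_vec_eq_0[OF c best_carrier] by blast
    then show "cs ! i = map best s ! i" using i by simp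
  qed
  show ?thesis
  proof
    assume "simultaneous_blip M X r s bs"
    then have bs: "?adm bs" "\<not> ?D (map best s) < ?D bs"
      using adm unfolding simultaneous_blip_def is_arg_min_def by blast+
    then have "?D bs = ?D (map best s)" using le[OF bs(1)] by linarith
    then show "bs = map best s" by (rule eq[OF bs(1)])
  next
    assume b: "bs = map best s"
    have "\<not> ?D cs < ?D bs" if "?adm cs" for cs
      using le[OF that] unfolding b by linarith
    then show "simultaneous_blip M X r s bs"
      using adm b unfolding simultaneous_blip_def is_arg_min_def by blast
  qed
qed

end

end

end

section \<open>Application to order statistics from a scale family\<close>

theorem theorem5:
  fixes M :: "'a measure" and f :: "real \<Rightarrow> real" and \<sigma> :: real
    and n r l :: nat and s :: "nat list"
    and Y X :: "nat \<Rightarrow> 'a \<Rightarrow> real"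
  assumes "prob_space M"
    and "prob_density f"
    and "\<sigma> > 0"
    and "1 \<le> r" and "r < n"
    and "1 \<le> l" and "length s = l" and "sorted_wrt (<) s" and "\<forall>k\<in>set s. r < k \<and> k \<le> n"
    and "iid_sample M n (\<lambda>x. 1 / \<sigma> * f (x / \<sigma>)) Y"
    and X: "X = order_stat n Y"
    and second_moments: "\<forall>i\<in>{1..n}. integrable M (\<lambda>\<omega>. (X i \<omega> / \<sigma>)\<^sup>2)"
    and "pos_def_matrix r (cov_matrix M (\<lambda>i \<omega>. X i \<omega> / \<sigma>) r)"
  shows "(\<forall>k\<in>set s. \<exists>!a. marginal_blip M X r k a) \<and>
    (\<exists>!as. simultaneous_blip M X r s as) \<and>
    (\<forall>as. simultaneous_blip M X r s as \<longleftrightarrow>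
       length as = l \<and> (\<forall>i<l. marginal_blip M X r (s ! i) (as ! i)))"
proof -
  interpret prob_space M by fact
  have ind: "indep_vars (\<lambda>_. borel) Y {1..n}"
    and dens: "\<And>j. j \<in> {1..n} \<Longrightarrow> distributed M lborel (Y j) (\<lambda>x. ennreal (1 / \<sigma> * f (x / \<sigma>)))"
    using assms(10) unfolding iid_sample_def by auto
  have Y: "Y j \<in> borel_measurable M" if "j \<in> {1..n}" for j
    using distributed_measurable[OF dens[OF that]] by simp
  have L: "lin_indep_variables M X n"
  proof (unfold_locales)
    fix j assume j: "j \<in> {1..n}"
    \<comment> \<open>The moment assumption concerns the standardized variables; the factor undoes
      the scaling.\<close>
    have "integrable M (\<lambda>\<omega>. \<sigma>\<^sup>2 * (X j \<omega> / \<sigma>)\<^sup>2)" using second_moments j by (intro integrable_mult_right) auto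
    then show "square_integrable M (X j)"
      using \<open>\<sigma> > 0\<close> order_stat_measurable[OF Y j] unfolding square_integrable_def X
      by (simp add: power_divide)
  next
    fix k and w :: "nat \<Rightarrow> real" assume "k \<in> {1..n}" "w k \<noteq> 0"
    then show "AE \<omega> in M. (\<Sum>j = 1..n. w j * X j \<omega>) \<noteq> 0"
      unfolding X by (intro AE_order_stat_lincomb_neq_0[OF ind] AE_distributed_lborel_neq[OF dens])
  qed
  have ss: "k \<in> {1..n}" if "k \<in> set s" for k using assms(9) that by auto
  have ds: "distinct s" using \<open>sorted_wrt (<) s\<close> by (simp add: strict_sorted_iff)
  note m = lin_indep_variables.marginal_blip_iff[OF L \<open>r < n\<close>]
  have sim: "simultaneous_blip M X r s as \<longleftrightarrow> as = map (lin_indep_variables.best M X r) s" for as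
    using lin_indep_variables.simultaneous_blip_iff[OF L \<open>r < n\<close> ds] assms(9) by blast
  \<comment> \<open>Both sides say that every component is the unique marginal solution for its
    rank.\<close>
  have "as = map (lin_indep_variables.best M X r) s \<longleftrightarrow>
      length as = l \<and> (\<forall>i<l. marginal_blip M X r (s ! i) (as ! i))" for as
    using ss m nth_mem \<open>length s = l\<close> by (auto simp: list_eq_iff_nth_eq)
  with sim have "\<forall>as. simultaneous_blip M X r s as \<longleftrightarrow>
      length as = l \<and> (\<forall>i<l. marginal_blip M X r (s ! i) (as ! i))" by simp
  moreover have "\<exists>!as. simultaneous_blip M X r s as" unfolding sim by simp
  moreover have "\<forall>k\<in>set s. \<exists>!a. marginal_blip M X r k a" using m ss by simp
  ultimately show ?thesis by blast
qed

end
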